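(* Let $K$ be a totally real extension of $\mathbb{Q}$ of infinite degree, and let $\mathcal{O}\subseteq\mathcal{O}_K$ be a subring such that $\operatorname{Frac}\mathcal{O}=K$. If $\mathcal{O}^+$ has the Northcott property with respect to the house, then there exists no universal quadratic $\mathcal{O}$-lattice.
   Context: An algebraic number is totally real (resp. totally positive) if all its conjugates, i.e. all roots of its minimal polynomial over $\mathbb{Q}$, are real (resp. positive real). A totally real extension of $\mathbb{Q}$ is an algebraic extension all of whose elements are totally real. For an algebraic extension $K/\mathbb{Q}$, $\mathcal{O}_K$ is the ring of elements of $K$ integral over $\mathbb{Z}$. For a subset $S\subseteq K$, $S^+$ is the set of totally positive elements of $S$. $\operatorname{Frac}$ denotes the fraction field. The house of an algebraic number $\alpha$ with conjugates $\alpha_1,\dots,\alpha_n$ is $\max_i|\alpha_i|$. A set $S\subseteq K$ has the Northcott property with respect to the house if for every $r\in\mathbb{R}$ there are only finitely many $\alpha\in S$ with house less than $r$. An $\mathcal{O}$-lattice is a finitely generated $\mathcal{O}$-module $\Lambda\subseteq V$, where $V$ is a finite-dimensional $K$-vector space. A quadratic map on $V$ is a map $Q:V\to K$ with $Q(av)=a^2Q(v)$ for all $a\in K$, $v\in V$, such that $B_Q(v,w)=\frac12(Q(v+w)-Q(v)-Q(w))$ is bilinear. A quadratic $\mathcal{O}$-lattice is a pair $(\Lambda,Q)$ of an $\mathcal{O}$-lattice and the restriction of a quadratic map to $\Lambda$. It is integral if $Q(\Lambda)\subseteq\mathcal{O}$; an integral quadratic $\mathcal{O}$-lattice is positive definite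 if $Q(v)$ is totally positive for every $0\neq v\in\Lambda$, and universal if it is positive definite and for every totally positive $d\in\mathcal{O}$ there is $v\in\Lambda$ with $Q(v)=d$. *)

theory Defs
  imports Complex_Main "HOL-Computational_Algebra.Polynomial"
begin

text \<open>
  The field \<open>K\<close> is a type \<open>'k\<close> of class \<^class>\<open>field_char_0\<close>. Since \<open>'k\<close> comes with no
  embedding into the complex numbers, the conjugates of \<open>x\<close> are the complex roots of its minimal
  polynomial over the rationals. The notions below are meant for algebraic \<open>x\<close>; for other
  \<open>x\<close> the description in \<open>min_poly\<close> denotes nothing.
\<close>

definition min_poly :: "'k::field_char_0 \<Rightarrow> rat poly" where
  "min_poly x = (THE p. lead_coeff p = 1 \<and> poly (map_poly of_rat p) x = 0 \<and>
     (\<forall>q. q \<noteq> 0 \<and> poly (map_poly of_rat q) x = 0 \<longrightarrow> degree p \<le> degree q))"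

lemma min_poly_ex1:
  fixes x :: "'k::field_char_0"
  assumes "algebraic x"
  shows "\<exists>!p. lead_coeff p = 1 \<and> poly (map_poly of_rat p) x = 0 \<and>
     (\<forall>q. q \<noteq> 0 \<and> poly (map_poly of_rat q) x = 0 \<longrightarrow> degree p \<le> degree q)"
proof -
  define R where "R = (\<lambda>p. p \<noteq> 0 \<and> poly (map_poly of_rat p) x = 0)"
  have ev: "poly (map_poly of_rat p) x = (\<Sum>i\<le>n. of_rat (coeff p i) * x ^ i)"
    if "degree p \<le> n" for p n
  proof -
    have "degree (map_poly of_rat p :: 'k poly) \<le> n"
      using that by (rule order.trans[OF map_poly_degree_leq])
    then have "poly (map_poly of_rat p) x =
        (\<Sum>i\<le>n. coeff (map_poly of_rat p) i * x ^ i)"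
      unfolding poly_altdef by (intro sum.mono_neutral_left) (auto simp: coeff_eq_0)
    then show ?thesis by (simp add: coeff_map_poly)
  qed
  obtain p0 where p0: "R p0"
  proof -
    obtain p :: "'k poly" where p: "\<And>i. coeff p i \<in> \<int>" "p \<noteq> 0" "poly p x = 0"
      using assms by (auto simp: algebraic_def)
    have "\<exists>c. \<forall>i. coeff p i = of_int (c i)"
      using p(1) by (intro choice) (auto elim!: Ints_cases)
    then obtain c where c: "\<And>i. coeff p i = of_int (c i)" by blast
    define q :: "rat poly" where "q = Abs_poly (\<lambda>i. of_int (c i))"
    have cz: "c i = 0" if "i > degree p" for i
      using coeff_eq_0[OF that] c[of i] by simp
    have cq: "coeff q i = of_int (c i)" for i
      unfolding q_def by (subst coeff_Abs_poly[of "degree p"]) (auto simp: cz)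
    have "map_poly of_rat q = p"
      by (rule poly_eqI) (simp add: coeff_map_poly cq c)
    with p have "R q" by (auto simp: R_def)
    then show ?thesis using that by blast
  qed
  define p1 where "p1 = (ARG_MIN degree p. R p)"
  have p1: "R p1" and min: "\<And>q. R q \<Longrightarrow> degree p1 \<le> degree q"
    unfolding p1_def using arg_min_natI[of R, OF p0] arg_min_nat_le[of R] by blast+
  have smult: "poly (map_poly of_rat (smult a p)) x = of_rat a * poly (map_poly of_rat p) x" for a p
    by (simp add: ev[of "smult a p" "degree p"] ev[of p "degree p"] degree_smult_le
        of_rat_mult sum_distrib_left mult.assoc)
  define p where "p = smult (inverse (lead_coeff p1)) p1"
  have p: "lead_coeff p = 1" "poly (map_poly of_rat p) x = 0" "degree p = degree p1"
    using p1 by (auto simp: p_def R_def smult)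
  show ?thesis
  proof (rule ex1I[of _ p])
    show "lead_coeff p = 1 \<and> poly (map_poly of_rat p) x = 0 \<and>
      (\<forall>q. q \<noteq> 0 \<and> poly (map_poly of_rat q) x = 0 \<longrightarrow> degree p \<le> degree q)"
      using p min by (auto simp: R_def)
  next
    fix q assume q: "lead_coeff q = 1 \<and> poly (map_poly of_rat q) x = 0 \<and>
      (\<forall>q'. q' \<noteq> 0 \<and> poly (map_poly of_rat q') x = 0 \<longrightarrow> degree q \<le> degree q')"
    then have q0: "q \<noteq> 0" by auto
    have d: "degree q = degree p"
      using q q0 p min p1 by (auto simp: R_def intro!: antisym)
    show "q = p"
    proof (rule ccontr)
      assume "q \<noteq> p"
      have "poly (map_poly of_rat (q - p)) x = 0"
        using q p d by (simp add: ev[of _ "degree p"] degree_diff_le of_rat_diff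
            left_diff_distrib sum_subtractf)
      with \<open>q \<noteq> p\<close> have "R (q - p)" by (simp add: R_def)
      then have ge: "degree p \<le> degree (q - p)" using min p by simp
      have "coeff (q - p) (degree p) = 0" using q p d by simp
      moreover have "degree (q - p) = degree p"
        using ge degree_diff_le[of q "degree p" p] d by simp
      ultimately have "q - p = 0" by (metis leading_coeff_0_iff)
      with \<open>q \<noteq> p\<close> show False by simp
    qed
  qed
qed

definition conjugates :: "'k::field_char_0 \<Rightarrow> complex set" where
  "conjugates x = {z. poly (map_poly of_rat (min_poly x)) z = 0}"

definition totally_real :: "'k::field_char_0 \<Rightarrow> bool" where
  "totally_real x \<longleftrightarrow> algebraic x \<and> conjugates x \<subseteq> \<real>"

definition totally_positive :: "'k::field_char_0 \<Rightarrow> bool" where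
  "totally_positive x \<longleftrightarrow> algebraic x \<and> (\<forall>z\<in>conjugates x. z \<in> \<real> \<and> Re z > 0)"

definition house :: "'k::field_char_0 \<Rightarrow> real" where
  "house x = Max (norm ` conjugates x)"

definition northcott_house :: "'k::field_char_0 set \<Rightarrow> bool" where
  "northcott_house S \<longleftrightarrow> (\<forall>r::real. finite {x\<in>S. house x < r})"

definition infinite_degree_over_rat :: "'k::field_char_0 itself \<Rightarrow> bool" where
  "infinite_degree_over_rat _ \<longleftrightarrow>
     \<not> (\<exists>B. finite_dimensional_vector_space (\<lambda>(q::rat) (x::'k). of_rat q * x) B)"

definition is_subring :: "'k::ring_1 set \<Rightarrow> bool" where
  "is_subring S \<longleftrightarrow> 1 \<in> S \<and> (\<forall>x\<in>S. \<forall>y\<in>S. x - y \<in> S \<and> x * y \<in> S)"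

definition Frac :: "'k::field set \<Rightarrow> 'k set" where
  "Frac S = {a / b | a b. a \<in> S \<and> b \<in> S \<and> b \<noteq> 0}"

text \<open>
  The ambient \<open>K\<close>-vector space \<open>V\<close> is a type \<open>'v\<close> with scalar multiplication \<open>scale\<close>. A lattice
  need not span \<open>V\<close>, nor be free over \<open>S\<close>.
\<close>

definition is_lattice ::
  "('k::field \<Rightarrow> 'v::ab_group_add \<Rightarrow> 'v) \<Rightarrow> 'k set \<Rightarrow> 'v set \<Rightarrow> bool" where
  "is_lattice scale S L \<longleftrightarrow> (\<exists>B. finite_dimensional_vector_space scale B) \<and>
     (\<exists>G. finite G \<and> L = {\<Sum>g\<in>G. scale (a g) g | a. \<forall>g\<in>G. a g \<in> S})"

definition polar :: "('v::ab_group_add \<Rightarrow> 'k::field) \<Rightarrow> 'v \<Rightarrow> 'v \<Rightarrow> 'k" where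
  "polar Q v w = (Q (v + w) - Q v - Q w) / 2"

definition quadratic_map ::
  "('k::field \<Rightarrow> 'v::ab_group_add \<Rightarrow> 'v) \<Rightarrow> ('v \<Rightarrow> 'k) \<Rightarrow> bool" where
  "quadratic_map scale Q \<longleftrightarrow> (\<forall>a v. Q (scale a v) = a\<^sup>2 * Q v) \<and>
     (\<forall>w. Vector_Spaces.linear scale (*) (\<lambda>v. polar Q v w)) \<and>
     (\<forall>v. Vector_Spaces.linear scale (*) (\<lambda>w. polar Q v w))"

text \<open>Only the values of \<open>q\<close> on \<open>L\<close> matter.\<close>

definition quadratic_lattice ::
  "('k::field \<Rightarrow> 'v::ab_group_add \<Rightarrow> 'v) \<Rightarrow> 'k set \<Rightarrow> 'v set \<Rightarrow> ('v \<Rightarrow> 'k) \<Rightarrow> bool" where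
  "quadratic_lattice scale S L q \<longleftrightarrow>
     is_lattice scale S L \<and> (\<exists>Q. quadratic_map scale Q \<and> (\<forall>v\<in>L. q v = Q v))"

definition integral_lattice ::
  "('k::field \<Rightarrow> 'v::ab_group_add \<Rightarrow> 'v) \<Rightarrow> 'k set \<Rightarrow> 'v set \<Rightarrow> ('v \<Rightarrow> 'k) \<Rightarrow> bool" where
  "integral_lattice scale S L q \<longleftrightarrow> quadratic_lattice scale S L q \<and> q ` L \<subseteq> S"

definition positive_definite_lattice ::
  "('k::field_char_0 \<Rightarrow> 'v::ab_group_add \<Rightarrow> 'v) \<Rightarrow> 'k set \<Rightarrow> 'v set \<Rightarrow> ('v \<Rightarrow> 'k) \<Rightarrow> bool" where
  "positive_definite_lattice scale S L q \<longleftrightarrow>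
     integral_lattice scale S L q \<and> (\<forall>v\<in>L. v \<noteq> 0 \<longrightarrow> totally_positive (q v))"

definition universal_lattice ::
  "('k::field_char_0 \<Rightarrow> 'v::ab_group_add \<Rightarrow> 'v) \<Rightarrow> 'k set \<Rightarrow> 'v set \<Rightarrow> ('v \<Rightarrow> 'k) \<Rightarrow> bool" where
  "universal_lattice scale S L q \<longleftrightarrow>
     positive_definite_lattice scale S L q \<and> (\<forall>d\<in>S. totally_positive d \<longrightarrow> (\<exists>v\<in>L. q v = d))"

end

theory Submission
  imports Defs "HOL-Computational_Algebra.Fundamental_Theorem_Algebra"
begin

text \<open>
  Conjugates of \<open>x\<close> are the values \<open>r x\<close> at the field embeddings \<open>r : K \<rightarrow> \<real>\<close>. Diagonalising,
  \<open>Q v = \<Sum>\<^sub>u y\<^sub>u\<^sup>2 Q u\<close> with finitely many totally positive \<open>Q u\<close> and coordinates \<open>y\<^sub>u\<close> that lie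
  in \<open>(1/d) \<O>\<close> for a fixed positive integer \<open>d\<close>. All summands are nonnegative under each \<open>r\<close>, so
  the house of \<open>d y\<^sub>u\<close> is at most a constant times the square root of the house of \<open>Q v\<close>.

  By the Northcott property and the infinite degree, some proper subring \<open>F \<supseteq> \<rat>\<close> of \<open>K\<close> contains
  every \<open>Q u\<close> and every element of \<open>\<O>\<^sup>+\<close> of house below a large bound. Let \<open>a = Q v\<close> have least
  house among the elements of \<open>\<O>\<^sup>+\<close> outside \<open>F\<close>. Some \<open>d y\<^sub>u\<close> is outside \<open>F\<close>, and adding an
  integer makes it totally positive with house still of the order of the square root of the house
  of \<open>a\<close>, which contradicts minimality.
\<close>

section \<open>Minimal polynomials\<close>

definition rat_eval :: "rat poly \<Rightarrow> 'a::field_char_0 \<Rightarrow> 'a" where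
  "rat_eval p x = poly (map_poly of_rat p) x"

lemma rat_eval_0 [simp]: "rat_eval 0 x = 0"
  by (simp add: rat_eval_def)

lemma rat_eval_pCons [simp]: "rat_eval (pCons a p) x = of_rat a + x * rat_eval p x"
  by (simp add: rat_eval_def map_poly_pCons)

lemma rat_eval_add: "rat_eval (p + q) x = rat_eval p x + rat_eval q x"
proof -
  have "map_poly of_rat (p + q) = (map_poly of_rat p + map_poly of_rat q :: 'a poly)"
    by (rule poly_eqI) (simp add: coeff_map_poly of_rat_add)
  then show ?thesis by (simp add: rat_eval_def)
qed

lemma rat_eval_smult: "rat_eval (smult a p) x = of_rat a * rat_eval p x"
  by (induction p) (simp_all add: of_rat_mult algebra_simps)

lemma rat_eval_mult: "rat_eval (p * q) x = rat_eval p x * rat_eval q x"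
  by (induction p) (simp_all add: rat_eval_add rat_eval_smult algebra_simps)

lemma rat_eval_diff: "rat_eval (p - q) x = rat_eval p x - rat_eval q x"
  using rat_eval_add[of "p - q" q x] by simp

lemma conjugates_iff: "z \<in> conjugates x \<longleftrightarrow> rat_eval (min_poly x) z = 0"
  by (simp add: conjugates_def rat_eval_def)

lemma min_poly:
  assumes "algebraic x"
  shows "lead_coeff (min_poly x) = 1" "rat_eval (min_poly x) x = 0"
    "q \<noteq> 0 \<Longrightarrow> rat_eval q x = 0 \<Longrightarrow> degree (min_poly x) \<le> degree q"
  using theI'[OF min_poly_ex1[OF assms]] unfolding min_poly_def[symmetric] rat_eval_def by blast+

lemma algebraic_imp_rat_eval:
  assumes "algebraic x"
  shows "\<exists>p. p \<noteq> 0 \<and> rat_eval p x = 0"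
proof (intro exI conjI)
  show "min_poly x \<noteq> 0" using min_poly(1)[OF assms] by auto
qed (rule min_poly(2)[OF assms])

text \<open>The remainder of \<open>q\<close> modulo \<open>min_poly x\<close> still vanishes at
  \<open>x\<close>, so minimality of the degree forces it to be zero.\<close>

lemma min_poly_dvd:
  assumes "algebraic x" "rat_eval q x = 0"
  shows "min_poly x dvd q"
proof (rule ccontr)
  assume *: "\<not> min_poly x dvd q"
  let ?m = "min_poly x"
  have "?m \<noteq> 0" using min_poly(1)[OF assms(1)] by auto
  have "q mod ?m \<noteq> 0" using * by (simp add: dvd_eq_mod_eq_0)
  moreover have "rat_eval (q mod ?m) x = 0"
    using assms by (simp add: minus_div_mult_eq_mod[symmetric] rat_eval_diff rat_eval_mult min_poly(2))
  ultimately show False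
    using min_poly(3)[OF assms(1)] degree_mod_less[OF \<open>?m \<noteq> 0\<close>, of q] by fastforce
qed

lemma finite_conjugates:
  assumes "algebraic x"
  shows "finite (conjugates x)"
proof -
  have "min_poly x \<noteq> 0" using min_poly(1)[OF assms] by auto
  then have "map_poly of_rat (min_poly x) \<noteq> (0::complex poly)"
    by (metis coeff_0 coeff_map_poly leading_coeff_0_iff of_rat_0 of_rat_eq_0_iff)
  then show ?thesis unfolding conjugates_def by (rule poly_roots_finite)
qed

text \<open>Strip factors of the variable from an integer polynomial vanishing at \<open>b\<close>
  until its constant term is nonzero; moving that term to the other side exhibits \<open>b\<close>
  as a divisor of an integer. This serves as a substitute for inverting \<open>b\<close> inside a
  ring.\<close>

lemma algebraic_dvd_int:
  fixes b :: "'a::field_char_0"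
  assumes "algebraic b" "b \<noteq> 0"
  shows "\<exists>q n. n \<noteq> 0 \<and> (\<forall>i. coeff q i \<in> \<int>) \<and> b * poly q b = of_int n"
proof -
  obtain p :: "'a poly" where p: "\<And>i. coeff p i \<in> \<int>" "p \<noteq> 0" "poly p b = 0"
    using assms by (auto simp: algebraic_def)
  then show ?thesis
  proof (induction p)
    case 0
    then show ?case by simp
  next
    case (pCons a p)
    have int: "coeff p i \<in> \<int>" for i using pCons.prems(1)[of "Suc i"] by simp
    show ?case
    proof (cases "a = 0")
      case True
      \<comment> \<open>A zero constant term means \<open>b * poly p b = 0\<close>, and
        \<open>b \<noteq> 0\<close> can be cancelled.\<close>
      then show ?thesis using pCons int assms(2) by (metis add_0 mult_eq_0_iff pCons_eq_0_iff poly_pCons)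
    next
      case False
      obtain n where n: "a = of_int n" using pCons.prems(1)[of 0] by (auto elim: Ints_cases)
      have "b * poly p b = of_int (- n)" using pCons.prems(3) n by (simp add: add_eq_0_iff)
      moreover have "- n \<noteq> 0" using False n by auto
      ultimately show ?thesis using int by blast
    qed
  qed
qed

section \<open>Subrings\<close>

lemma is_subring_closed:
  assumes "is_subring S"
  shows "0 \<in> S" "1 \<in> S" "x \<in> S \<Longrightarrow> y \<in> S \<Longrightarrow> x + y \<in> S" "x \<in> S \<Longrightarrow> y \<in> S \<Longrightarrow> x - y \<in> S"
    "x \<in> S \<Longrightarrow> y \<in> S \<Longrightarrow> x * y \<in> S" "x \<in> S \<Longrightarrow> - x \<in> S"
proof -
  show 0: "0 \<in> S" using assms unfolding is_subring_def by (metis diff_self)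
  have m: "u \<in> S \<Longrightarrow> - u \<in> S" for u using assms 0 unfolding is_subring_def by (metis diff_0)
  then show "x \<in> S \<Longrightarrow> - x \<in> S" .
  show "x \<in> S \<Longrightarrow> y \<in> S \<Longrightarrow> x + y \<in> S"
    using assms m unfolding is_subring_def by (metis diff_minus_eq_add)
qed (use assms in \<open>auto simp: is_subring_def\<close>)

lemma is_subring_sum: "is_subring S \<Longrightarrow> (\<And>i. i \<in> I \<Longrightarrow> f i \<in> S) \<Longrightarrow> sum f I \<in> S"
  by (induction I rule: infinite_finite_induct) (auto simp: is_subring_closed)

lemma is_subring_of_nat: "is_subring S \<Longrightarrow> of_nat n \<in> S"
  by (induction n) (auto simp: is_subring_closed)

lemma is_subring_of_int: "is_subring S \<Longrightarrow> of_int n \<in> S"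
  by (cases n rule: int_cases2) (auto simp: is_subring_closed is_subring_of_nat)

lemma is_subring_poly:
  assumes S: "is_subring S" and "x \<in> S" "\<And>i. coeff p i \<in> S"
  shows "poly p x \<in> S"
  using assms(3)
proof (induction p)
  case 0
  then show ?case by (simp add: is_subring_closed[OF S])
next
  case (pCons a p)
  have "a \<in> S" using pCons.prems[of 0] by simp
  moreover have "poly p x \<in> S" using pCons.prems[of "Suc _"] by (intro pCons.IH) simp
  ultimately show ?case using assms(2) by (simp add: is_subring_closed[OF S])
qed

section \<open>Conjugates and field embeddings\<close>

text \<open>The target is left polymorphic: embeddings are first built into \<complex> and then
  turned into embeddings into \<real>. Compatibility with differences, inverses and rationals
  follows from these clauses.\<close>

definition embedding :: "('k::field_char_0 \<Rightarrow> 'a::field_char_0) \<Rightarrow> bool" where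
  "embedding s \<longleftrightarrow> s 1 = 1 \<and> (\<forall>x y. s (x + y) = s x + s y \<and> s (x * y) = s x * s y)"

text \<open>The graph of a ring homomorphism from a \<open>\<rat>\<close>-subalgebra of \<open>K\<close> to \<open>\<complex>\<close>.\<close>

definition functional_subring :: "('k::field_char_0 \<times> complex) set \<Rightarrow> bool" where
  "functional_subring G \<longleftrightarrow>
     (\<forall>q. (of_rat q, of_rat q) \<in> G) \<and>
     (\<forall>a b c d. (a, b) \<in> G \<and> (c, d) \<in> G \<longrightarrow> (a - c, b - d) \<in> G \<and> (a * c, b * d) \<in> G) \<and>
     (\<forall>b. (0, b) \<in> G \<longrightarrow> b = 0)"

lemma functional_subringD:
  assumes "functional_subring G"
  shows "(of_rat q, of_rat q) \<in> G" "(0, 0) \<in> G" "(1, 1) \<in> G"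
    "(a, b) \<in> G \<Longrightarrow> (c, d) \<in> G \<Longrightarrow> (a - c, b - d) \<in> G"
    "(a, b) \<in> G \<Longrightarrow> (c, d) \<in> G \<Longrightarrow> (a + c, b + d) \<in> G"
    "(a, b) \<in> G \<Longrightarrow> (c, d) \<in> G \<Longrightarrow> (a * c, b * d) \<in> G"
    "(0, b) \<in> G \<Longrightarrow> b = 0"
proof -
  note G = assms[unfolded functional_subring_def]
  show "(of_rat q, of_rat q) \<in> G" using G by blast
  show 0: "(0, 0) \<in> G" using G by (metis of_rat_0)
  show "(1, 1) \<in> G" using G by (metis of_rat_1)
  show d: "(a, b) \<in> G \<Longrightarrow> (c, d) \<in> G \<Longrightarrow> (a - c, b - d) \<in> G" for a b c d using G by blast
  show "(a, b) \<in> G \<Longrightarrow> (c, d) \<in> G \<Longrightarrow> (a * c, b * d) \<in> G" using G by blast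
  show "(0, b) \<in> G \<Longrightarrow> b = 0" using G by blast
  show "(a, b) \<in> G \<Longrightarrow> (c, d) \<in> G \<Longrightarrow> (a + c, b + d) \<in> G"
    using d[OF _ d[OF 0]] by fastforce
qed

lemma functional_subring_sum:
  assumes "functional_subring G" "\<And>i. i \<in> I \<Longrightarrow> (f i, g i) \<in> G"
  shows "(sum f I, sum g I) \<in> G"
  using assms(2)
  by (induction I rule: infinite_finite_induct) (auto simp: functional_subringD[OF assms(1)])

text \<open>By algebraicity, \<open>a\<close> times an integer polynomial in \<open>a\<close> is a
  nonzero integer \<open>n\<close>. The graph sends this product to \<open>n\<close>, so the image
  \<open>b\<close> is nonzero, and dividing the cofactor by \<open>n\<close> gives the inverse.
  Graphs thus need not be assumed closed under inverses.\<close>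

lemma functional_subring_inverse:
  assumes G: "functional_subring G" and alg: "algebraic a" and ab: "(a, b) \<in> G" "a \<noteq> 0"
  obtains "b \<noteq> 0" "(inverse a, inverse b) \<in> G"
proof -
  obtain q n where q: "n \<noteq> 0" "\<And>i. coeff q i \<in> \<int>" "a * poly q a = of_int n"
    using algebraic_dvd_int[OF alg ab(2)] by blast
  have pw: "\<exists>c. (poly q a, c) \<in> G" using q(2)
  proof (induction q)
    case 0
    then show ?case using functional_subringD(2)[OF G] by auto
  next
    case (pCons e q)
    have "coeff q i \<in> \<int>" for i using pCons.prems[of "Suc i"] by simp
    then obtain c where c: "(poly q a, c) \<in> G" using pCons.IH by blast
    obtain m where "e = of_int m" using pCons.prems[of 0] by (auto elim: Ints_cases)
    then have "e = of_rat (of_int m)" by simp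
    then show ?case using functional_subringD[OF G] ab(1) c by (metis poly_pCons)
  qed
  then obtain c where c: "(poly q a, c) \<in> G" by blast
  have int: "(of_int n, of_int n) \<in> G" using functional_subringD(1)[OF G, of "of_int n"] by simp
  \<comment> \<open>The first component is 0, so the second one must be 0 as well.\<close>
  have "(a * poly q a - of_int n, b * c - of_int n) \<in> G"
    using functional_subringD(4,6)[OF G] ab c int by blast
  then have bc: "b * c = of_int n" using functional_subringD(7)[OF G, of "b * c - of_int n"] q(3) by simp
  then have b: "b \<noteq> 0" using q(1) by auto
  have "(of_rat (inverse (of_int n)) * poly q a, of_rat (inverse (of_int n)) * c) \<in> G"
    using functional_subringD(1,6)[OF G] c by blast
  moreover have "of_rat (inverse (of_int n)) * poly q a = inverse a"
    using q(1,3) ab(2) by (simp add: of_rat_inverse) (simp add: field_simps)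
  moreover have "of_rat (inverse (of_int n)) * c = inverse b"
    using bc b q(1) by (simp add: of_rat_inverse) (simp add: field_simps)
  ultimately show thesis using b that by simp
qed

lemma functional_subring_extend:
  fixes x :: "'k::field_char_0"
  assumes G: "functional_subring G" and alg: "\<And>a::'k. algebraic a"
  shows "\<exists>G'. functional_subring G' \<and> G \<subseteq> G' \<and> x \<in> fst ` G'"
proof -
  \<comment> \<open>Pairs in \<open>R\<close> are a polynomial over the domain of \<open>G\<close> and its image over \<open>\<complex>\<close>. The new value
    \<open>w\<close> at \<open>x\<close> is a root of the image \<open>H0\<close> of a polynomial \<open>F0\<close> of least degree vanishing at \<open>x\<close>.\<close>
  note GD = functional_subringD[OF G]
  define R where "R = {(F, H). \<forall>i. (coeff F i, coeff H i) \<in> G}"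
  have const: "([:a:], [:b:]) \<in> R" if "(a, b) \<in> G" for a b
    using that GD(2) by (auto simp: R_def coeff_pCons split: nat.split)
  have var: "([:0, 1:], [:0, 1:]) \<in> R"
    using GD(2,3) by (auto simp: R_def coeff_pCons split: nat.split)
  have diff: "(F - F', H - H') \<in> R" if "(F, H) \<in> R" "(F', H') \<in> R" for F F' H H'
    using that GD(4) by (auto simp: R_def)
  have mult: "(F * F', H * H') \<in> R" if "(F, H) \<in> R" "(F', H') \<in> R" for F F' H H'
    using that by (auto simp: R_def coeff_mult intro!: functional_subring_sum[OF G] GD(6))
  have H0: "H = 0" if "(0, H) \<in> R" for H
    using that GD(7) by (auto simp: R_def intro!: poly_eqI)
  \<comment> \<open>Nonzero elements of the domain have nonzero images, because they are invertible
    in \<open>G\<close>; so \<open>F\<close> and \<open>H\<close> have the same nonzero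
    coefficients.\<close>
  have deg: "degree F = degree H" if FH: "(F, H) \<in> R" for F H
  proof -
    have "coeff F i = 0 \<longleftrightarrow> coeff H i = 0" for i
      using FH GD(7) functional_subring_inverse[OF G alg, of "coeff F i" "coeff H i"]
      unfolding R_def by (cases "coeff F i = 0") (auto, metis)
    then show ?thesis by (simp add: degree_def)
  qed
  define S where "S = (\<lambda>(F, H). (F, H) \<in> R \<and> F \<noteq> 0 \<and> poly F x = 0)"
  obtain p where p: "p \<noteq> 0" "rat_eval p x = 0"
    using algebraic_imp_rat_eval[OF alg] by blast
  have "S (map_poly of_rat p, map_poly of_rat p)"
  proof -
    have "map_poly of_rat p \<noteq> (0::'k poly)"
      using p(1) by (metis coeff_0 coeff_map_poly leading_coeff_0_iff of_rat_0 of_rat_eq_0_iff)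
    then show ?thesis using p by (auto simp: S_def R_def coeff_map_poly GD(1) rat_eval_def)
  qed
  then obtain P where P: "S P" and Pmin: "\<And>P'. S P' \<Longrightarrow> degree (fst P) \<le> degree (fst P')"
    using arg_min_natI[of S _ "\<lambda>P. degree (fst P)"] arg_min_nat_le[of S _ "\<lambda>P. degree (fst P)"] by metis
  obtain F0 H0 where P_eq: "P = (F0, H0)" by force
  have F0: "(F0, H0) \<in> R" "F0 \<noteq> 0" "poly F0 x = 0" using P P_eq by (auto simp: S_def)
  \<comment> \<open>A nonzero constant has no root, so \<open>F0\<close> is nonconstant, and so is
    \<open>H0\<close>, which therefore has a complex root.\<close>
  have "degree F0 \<noteq> 0" using F0(2,3) by (metis degree_eq_zeroE pCons_0_0 poly_0 poly_const_conv)
  then obtain w where w: "poly H0 w = 0"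
    using fundamental_theorem_of_algebra[of H0] deg[OF F0(1)] constant_degree by metis
  have lead: "(lead_coeff F0, lead_coeff H0) \<in> G" using F0(1) deg[OF F0(1)] by (auto simp: R_def)
  \<comment> \<open>Well-definedness of the new value, by division with remainder: cancel the
    leading term of \<open>F\<close> with a multiple of \<open>F0\<close>. The parallel step on
    \<open>H\<close> subtracts a multiple of \<open>H0\<close>, which vanishes at
    \<open>w\<close>.\<close>
  have kill: "poly H w = 0" if "(F, H) \<in> R" "poly F x = 0" for F H
    using that
  proof (induction "degree F" arbitrary: F H rule: less_induct)
    case less
    show ?case
    proof (cases "F = 0")
      case True
      then have "H = 0" using less.prems H0 by blast
      then show ?thesis by simp
    next
      case False
      then have le: "degree F0 \<le> degree F" using Pmin[of "(F, H)"] less.prems P_eq by (simp add: S_def)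
      define k where "k = degree F - degree F0"
      have lead': "(lead_coeff F, lead_coeff H) \<in> G"
        using less.prems(1) deg[OF less.prems(1)] by (auto simp: R_def)
      define a b where "a = lead_coeff F * inverse (lead_coeff F0)"
        and "b = lead_coeff H * inverse (lead_coeff H0)"
      have ab: "(a, b) \<in> G" unfolding a_def b_def
        using functional_subring_inverse[OF G alg lead] F0(2) lead' GD(6) by (metis leading_coeff_0_iff)
      have X: "(monom 1 k, monom 1 k) \<in> R" using GD(2,3) by (auto simp: R_def)
      define F' H' where "F' = F - [:a:] * (monom 1 k * F0)" and "H' = H - [:b:] * (monom 1 k * H0)"
      have R': "(F', H') \<in> R" unfolding F'_def H'_def
        by (intro diff mult const X ab F0(1) less.prems(1))
      have ev: "poly F' x = 0" using less.prems(2) F0(3) by (simp add: F'_def)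
      have "poly H' w = 0"
      proof (cases "F' = 0")
        case True
        then have "H' = 0" using R' H0 by blast
        then show ?thesis by simp
      next
        case False
        have "degree ([:a:] * (monom 1 k * F0)) \<le> degree F"
          using F0(2) le by (simp add: degree_mult_eq degree_monom_eq k_def)
        then have d: "degree F' \<le> degree F" unfolding F'_def by (intro degree_diff_le) auto
        have "coeff (monom 1 k * F0) (degree F) = lead_coeff F0"
          using le by (simp add: coeff_monom_mult k_def)
        then have "coeff F' (degree F) = 0" using F0(2) by (simp add: F'_def a_def)
        then have "degree F' < degree F"
          using d False by (metis le_neq_implies_less leading_coeff_0_iff)
        then show ?thesis using less.hyps R' ev by blast
      qed
      then show ?thesis using w by (simp add: H'_def)
    qed
  qed
  \<comment> \<open>This is the graph of \<open>poly F x \<mapsto> poly H w\<close>; constants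
    recover \<open>G\<close>, and the variable puts \<open>x\<close> into the domain.\<close>
  define G' where "G' = (\<lambda>(F, H). (poly F x, poly H w)) ` R"
  have memI: "(poly F x, poly H w) \<in> G'" if "(F, H) \<in> R" for F H
    using that unfolding G'_def by force
  have sub: "(a, b) \<in> G'" if "(a, b) \<in> G" for a b
    using memI[OF const[OF that]] by simp
  have "functional_subring G'"
    unfolding functional_subring_def
  proof (intro conjI allI impI)
    show "(of_rat q, of_rat q) \<in> G'" for q using sub GD(1) by blast
  next
    fix a b c d assume "(a, b) \<in> G' \<and> (c, d) \<in> G'"
    then obtain F H F' H' where FH: "(F, H) \<in> R" "(F', H') \<in> R"
      "a = poly F x" "b = poly H w" "c = poly F' x" "d = poly H' w"
      unfolding G'_def by auto
    show "(a - c, b - d) \<in> G'" using memI[OF diff[OF FH(1,2)]] FH by simp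
    show "(a * c, b * d) \<in> G'" using memI[OF mult[OF FH(1,2)]] FH by simp
  next
    show "b = 0" if "(0, b) \<in> G'" for b
      using that kill unfolding G'_def by auto
  qed
  moreover have "x \<in> fst ` G'" using memI[OF var] by force
  ultimately show ?thesis using sub by auto
qed

text \<open>Sending \<open>y\<close> to \<open>w\<close> is well defined on polynomials in
  \<open>y\<close>, since \<open>min_poly y\<close> divides every relation. Zorn's lemma gives a
  maximal extension of this graph, and the one-element extension shows that its domain is all of
  \<open>K\<close>.\<close>

lemma conjugate_imp_embedding:
  fixes y :: "'k::field_char_0"
  assumes alg: "\<And>a::'k. algebraic a" and w: "w \<in> conjugates y"
  shows "\<exists>s. embedding s \<and> s y = w"
proof -
  define G0 where "G0 = range (\<lambda>p. (rat_eval p y, rat_eval p w))"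
  have mem: "(rat_eval p y, rat_eval p w) \<in> G0" for p by (auto simp: G0_def)
  have G0: "functional_subring G0"
    unfolding functional_subring_def
  proof (intro conjI allI impI)
    show "(of_rat q, of_rat q) \<in> G0" for q using mem[of "[:q:]"] by simp
  next
    fix a b c d assume "(a, b) \<in> G0 \<and> (c, d) \<in> G0"
    then obtain p q where pq: "a = rat_eval p y" "b = rat_eval p w" "c = rat_eval q y" "d = rat_eval q w"
      unfolding G0_def by auto
    show "(a - c, b - d) \<in> G0" using mem[of "p - q"] pq by (simp add: rat_eval_diff)
    show "(a * c, b * d) \<in> G0" using mem[of "p * q"] pq by (simp add: rat_eval_mult)
  next
    fix b assume "(0, b) \<in> G0"
    then obtain p where p: "rat_eval p y = 0" "b = rat_eval p w" unfolding G0_def by auto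
    from min_poly_dvd[OF alg p(1)] show "b = 0"
      using w p(2) by (auto simp: dvd_def rat_eval_mult conjugates_iff)
  qed
  define A where "A = {G. functional_subring G \<and> G0 \<subseteq> G}"
  have "\<exists>M\<in>A. \<forall>X\<in>A. M \<subseteq> X \<longrightarrow> X = M"
  proof (rule subset_Zorn_nonempty)
    show "A \<noteq> {}" using G0 by (auto simp: A_def)
  next
    fix C assume C: "C \<noteq> {}" "subset.chain A C"
    have CA: "\<And>G. G \<in> C \<Longrightarrow> functional_subring G \<and> G0 \<subseteq> G"
      using C(2) by (auto simp: subset.chain_def A_def)
    have "functional_subring (\<Union>C)"
      unfolding functional_subring_def
    proof (intro conjI allI impI)
      show "(of_rat q, of_rat q) \<in> \<Union>C" for q using C(1) CA functional_subringD(1) by blast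
    next
      fix a b c d assume "(a, b) \<in> \<Union>C \<and> (c, d) \<in> \<Union>C"
      then obtain X Y where XY: "X \<in> C" "Y \<in> C" "(a, b) \<in> X" "(c, d) \<in> Y" by blast
      then have "X \<subseteq> Y \<or> Y \<subseteq> X" using C(2) unfolding subset_chain_def by blast
      then obtain Z where "Z \<in> C" "(a, b) \<in> Z" "(c, d) \<in> Z" using XY by blast
      then show "(a - c, b - d) \<in> \<Union>C" "(a * c, b * d) \<in> \<Union>C"
        using CA functional_subringD(4,6) by blast+
    next
      show "b = 0" if "(0, b) \<in> \<Union>C" for b using that CA functional_subringD(7) by blast
    qed
    then show "\<Union>C \<in> A" using C(1) CA by (auto simp: A_def)
  qed
  then obtain M where "M \<in> A" and maxA: "\<And>X. X \<in> A \<Longrightarrow> M \<subseteq> X \<Longrightarrow> X = M"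
    by blast
  then have M: "functional_subring M" "G0 \<subseteq> M" by (auto simp: A_def)
  have max: "X = M" if "functional_subring X" "G0 \<subseteq> X" "M \<subseteq> X" for X
    using maxA[of X] that by (simp add: A_def)
  have "\<exists>b. (a, b) \<in> M" for a
  proof -
    obtain M' where M': "functional_subring M'" "M \<subseteq> M'" "a \<in> fst ` M'"
      using functional_subring_extend[OF M(1) alg] by blast
    then have "M' = M" using max[of M'] M(2) by blast
    then show ?thesis using M'(3) by auto
  qed
  then obtain s where s: "\<And>a. (a, s a) \<in> M" by metis
  have uniq: "s a = b" if "(a, b) \<in> M" for a b
    using functional_subringD(4)[OF M(1) s[of a] that] functional_subringD(7)[OF M(1), of "s a - b"] by simp
  have "embedding s"
    unfolding embedding_def
    using uniq[OF functional_subringD(3)[OF M(1)]]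
      uniq[OF functional_subringD(5)[OF M(1) s s]] uniq[OF functional_subringD(6)[OF M(1) s s]]
    by blast
  moreover have "s y = w"
    using mem[of "[:0, 1:]"] M(2) uniq[of y w] by auto
  ultimately show ?thesis by blast
qed

lemma embedding_simps:
  assumes "embedding s"
  shows "s 0 = 0" "s 1 = 1" "s (x + y) = s x + s y" "s (x * y) = s x * s y"
    "s (- x) = - s x" "s (x - y) = s x - s y" "s (x ^ n) = s x ^ n" "s (of_nat n) = of_nat n"
proof -
  show [simp]: "s 1 = 1" and add: "\<And>x y. s (x + y) = s x + s y" and mult: "s (x * y) = s x * s y" for x y
    using assms by (auto simp: embedding_def)
  show [simp]: "s 0 = 0" using add[of 0 0] by simp
  show minus: "s (- x) = - s x" for x using add[of x "- x"] by (simp add: eq_neg_iff_add_eq_0 add.commute)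
  show "s (x - y) = s x - s y" using add[of x "- y"] minus by simp
  show "s (x ^ n) = s x ^ n" by (induction n) (simp_all add: mult)
  show "s (of_nat n) = of_nat n" by (induction n) (simp_all add: add)
qed

lemma embedding_sum: "embedding s \<Longrightarrow> s (sum f I) = (\<Sum>i\<in>I. s (f i))"
  by (induction I rule: infinite_finite_induct) (simp_all add: embedding_simps)

lemma embedding_inverse:
  assumes "embedding s"
  shows "s (inverse x) = inverse (s x)"
proof (cases "x = 0")
  case False
  then have "s x * s (inverse x) = 1"
    using embedding_simps(2,4)[OF assms] by (metis right_inverse)
  then show ?thesis by (rule inverse_unique[symmetric])
qed (simp add: embedding_simps[OF assms])

lemma embedding_of_rat: "embedding s \<Longrightarrow> s (of_rat q) = of_rat q"
proof (induction q)
  case (Fract a b)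
  have i: "s (of_int n) = of_int n" for n
    using Fract by (cases n rule: int_cases2) (simp_all add: embedding_simps)
  show ?case
    using Fract by (simp add: of_rat_rat divide_inverse embedding_simps embedding_inverse i)
qed

lemma embedding_rat_eval: "embedding s \<Longrightarrow> s (rat_eval p x) = rat_eval p (s x)"
  by (induction p) (simp_all add: embedding_simps embedding_of_rat)

text \<open>Together with finiteness, this makes the \<open>Max\<close> in \<open>house\<close> a
  genuine maximum.\<close>

lemma conjugates_nonempty:
  assumes "algebraic x"
  shows "conjugates x \<noteq> {}"
proof -
  have "degree (min_poly x) \<noteq> 0"
  proof
    assume "degree (min_poly x) = 0"
    then obtain a where a: "min_poly x = [:a:]" by (rule degree_eq_zeroE)
    then show False using min_poly(1,2)[OF assms] by simp
  qed
  moreover have "degree (map_poly of_rat (min_poly x) :: complex poly) = degree (min_poly x)"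
    by (rule map_poly_degree_eq) (use min_poly(1)[OF assms] in auto)
  ultimately obtain z where "poly (map_poly of_rat (min_poly x)) z = (0::complex)"
    using fundamental_theorem_of_algebra constant_degree by metis
  then show ?thesis by (auto simp: conjugates_def)
qed

text \<open>Complex embeddings take values among conjugates, which are real by assumption.
  Positivity and house can then be computed through maps that respect sums and products, which roots
  of separate minimal polynomials do not offer.\<close>

lemma conjugates_eq_image_embeddings:
  fixes x :: "'k::field_char_0"
  assumes tr: "\<And>x::'k. totally_real x"
  shows "conjugates x = (\<lambda>r. complex_of_real (r x)) ` {r. embedding r}"
proof -
  have alg: "algebraic x" for x :: 'k using tr by (simp add: totally_real_def)
  have conj: "s y \<in> conjugates y" if "embedding s" for s and y :: 'k
    using embedding_rat_eval[OF that, of "min_poly y" y] min_poly(2)[OF alg]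
      embedding_simps(1)[OF that] by (simp add: conjugates_iff)
  show ?thesis
  proof (intro subset_antisym subsetI)
    fix w assume "w \<in> conjugates x"
    then obtain s where s: "embedding s" "s x = w" using conjugate_imp_embedding[OF alg] by blast
    have eq: "s y = of_real (Re (s y))" for y
      using conj[OF s(1)] tr[of y] unfolding totally_real_def by (metis of_real_Re subsetD)
    have im: "Im (s y) = 0" for y by (metis eq Im_complex_of_real)
    \<comment> \<open>Taking real parts is multiplicative here only because all imaginary parts
      vanish.\<close>
    have "embedding (\<lambda>y. Re (s y))"
      using s(1) by (simp add: embedding_def im)
    then show "w \<in> (\<lambda>r. complex_of_real (r x)) ` {r. embedding r}"
      using s(2) eq by (intro image_eqI[of _ _ "\<lambda>y. Re (s y)"]) auto
  next
    fix w assume "w \<in> (\<lambda>r. complex_of_real (r x)) ` {r. embedding r}"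
    then obtain r where r: "embedding r" "w = complex_of_real (r x)" by blast
    have "embedding (\<lambda>y. complex_of_real (r y))" using r(1) by (simp add: embedding_def)
    then show "w \<in> conjugates x" using conj r(2) by blast
  qed
qed

lemma totally_positive_iff_embeddings:
  fixes x :: "'k::field_char_0"
  assumes tr: "\<And>x::'k. totally_real x"
  shows "totally_positive x \<longleftrightarrow> (\<forall>r::'k \<Rightarrow> real. embedding r \<longrightarrow> r x > 0)"
  using tr[of x] by (auto simp: totally_positive_def totally_real_def conjugates_eq_image_embeddings[OF tr])

text \<open>The house is the maximum of a finite nonempty set of absolute values.
  \<open>house_attained\<close> is also the source of at least one real embedding.\<close>

lemma
  fixes x :: "'k::field_char_0"
  assumes tr: "\<And>x::'k. totally_real x"
  shows abs_embedding_le_house: "embedding r \<Longrightarrow> \<bar>r x\<bar> \<le> house x"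
    and house_attained: "\<exists>r. embedding r \<and> house x = \<bar>r x\<bar>"
proof -
  have alg: "algebraic x" using tr by (simp add: totally_real_def)
  have eq: "norm ` conjugates x = (\<lambda>r. \<bar>r x\<bar>) ` {r. embedding r}"
    by (simp add: conjugates_eq_image_embeddings[OF tr] image_image)
  have fin: "finite (norm ` conjugates x)" using finite_conjugates[OF alg] by simp
  show "\<bar>r x\<bar> \<le> house x" if "embedding r"
    unfolding house_def using fin that by (intro Max_ge) (auto simp: eq)
  have "house x \<in> norm ` conjugates x"
    unfolding house_def using fin conjugates_nonempty[OF alg] by (intro Max_in) auto
  then show "\<exists>r. embedding r \<and> house x = \<bar>r x\<bar>" by (auto simp: eq)
qed

section \<open>Common denominators\<close>

text \<open>Write \<open>x = a / b\<close>; a multiple of \<open>b\<close> by an element of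
  \<open>\<O>\<close> is a nonzero integer, and the same multiplier clears the denominator of
  \<open>x\<close>. The sign is then adjusted.\<close>

lemma is_subring_denominator:
  fixes \<O> :: "'k::field_char_0 set"
  assumes "is_subring \<O>" "Frac \<O> = UNIV" and alg: "\<And>x::'k. algebraic x"
  shows "\<exists>n::nat. n > 0 \<and> of_nat n * x \<in> \<O>"
proof -
  obtain a b where ab: "x = a / b" "a \<in> \<O>" "b \<in> \<O>" "b \<noteq> 0"
    using assms(2) unfolding Frac_def by blast
  obtain q n where q: "n \<noteq> 0" "\<And>i. coeff q i \<in> \<int>" "b * poly q b = of_int n"
    using algebraic_dvd_int[OF alg ab(4)] by blast
  have "coeff q i \<in> \<O>" for i
    using q(2)[of i] is_subring_of_int[OF assms(1)] by (auto elim: Ints_cases)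
  then have "poly q b \<in> \<O>" by (rule is_subring_poly[OF assms(1) ab(3)])
  moreover have "of_int n * x = a * poly q b" using q(3)[symmetric] ab(1,4) by simp
  ultimately have m: "of_int n * x \<in> \<O>" using is_subring_closed(5)[OF assms(1)] ab(2) by simp
  have "of_nat (nat \<bar>n\<bar>) * x = of_int n * x \<or> of_nat (nat \<bar>n\<bar>) * x = - (of_int n * x)"
    by (cases "n \<ge> 0") (simp_all add: of_nat_nat)
  then have "of_nat (nat \<bar>n\<bar>) * x \<in> \<O>" using m is_subring_closed(6)[OF assms(1)] by metis
  then show ?thesis using q(1) by (intro exI[of _ "nat \<bar>n\<bar>"]) simp
qed

lemma is_subring_common_denominator:
  fixes \<O> :: "'k::field_char_0 set"
  assumes \<O>: "is_subring \<O>" "Frac \<O> = UNIV" "\<And>x::'k. algebraic x" and "finite X"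
  shows "\<exists>n::nat. n > 0 \<and> (\<forall>x\<in>X. of_nat n * x \<in> \<O>)"
  using assms(4)
proof induction
  case empty
  then show ?case by auto
next
  case (insert x X)
  obtain n where n: "n > 0" "\<And>y. y \<in> X \<Longrightarrow> of_nat n * y \<in> \<O>" using insert.IH by blast
  obtain m where m: "m > 0" "of_nat m * x \<in> \<O>" using is_subring_denominator[OF \<O>] by blast
  have "of_nat (m * n) * y = of_nat n * (of_nat m * y)" "of_nat (m * n) * y = of_nat m * (of_nat n * y)"
    for y :: 'k by simp_all
  then have "of_nat (m * n) * y \<in> \<O>" if "y \<in> insert x X" for y
    using that n(2) m(2) is_subring_closed(5)[OF \<O>(1) is_subring_of_nat[OF \<O>(1)]]
    by (metis insert_iff)
  then show ?case using m(1) n(1) by (intro exI[of _ "m * n"]) simp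
qed

section \<open>Finitely generated subalgebras\<close>

lemma vector_space_rat:
  "vector_space (\<lambda>(q::rat) (x::'k::field_char_0). of_rat q * x)"
  by unfold_locales (simp_all add: algebra_simps of_rat_add of_rat_mult)

text \<open>Adjoin the elements one at a time. For a new \<open>t\<close> of degree
  \<open>n\<close>, the products \<open>b * t ^ i\<close> with \<open>i < n\<close> suffice, because
  the minimal polynomial rewrites \<open>t ^ n\<close> in lower powers.\<close>

lemma finite_dimensional_subalgebra:
  fixes T :: "'k::field_char_0 set"
  assumes alg: "\<And>x::'k. algebraic x" and "finite T"
  defines "rat_span \<equiv> module.span (\<lambda>(q::rat) (x::'k). of_rat q * x)"
  shows "\<exists>B. finite B \<and> T \<subseteq> rat_span B \<and> 1 \<in> rat_span B \<and> 
    (\<forall>x\<in>rat_span B. \<forall>y\<in>rat_span B. x * y \<in> rat_span B)"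
  using assms(2)
proof induction
  interpret V: vector_space "\<lambda>(q::rat) (x::'k). of_rat q * x" by (rule vector_space_rat)
  case empty
  have "V.span {1} = range (\<lambda>q. of_rat q)" by (auto simp: V.span_singleton)
  then show ?case
    unfolding rat_span_def
    by (intro exI[of _ "{1}"]) (auto simp: V.span_base simp flip: of_rat_mult)
next
  interpret V: vector_space "\<lambda>(q::rat) (x::'k). of_rat q * x" by (rule vector_space_rat)
  case (insert t T)
  obtain B where B: "finite B" "T \<subseteq> V.span B" "1 \<in> V.span B"
    "\<And>x y. x \<in> V.span B \<Longrightarrow> y \<in> V.span B \<Longrightarrow> x * y \<in> V.span B"
    using insert.IH unfolding rat_span_def by blast
  define n where "n = degree (min_poly t)"
  define B' where "B' = (\<lambda>(b, i). b * t ^ i) ` (B \<times> {..<n})"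
  \<comment> \<open>Multiplication by \<open>c\<close> is \<rat>-linear, so it only has to be
    checked on generators.\<close>
  have stable: "c * x \<in> V.span Y" if "x \<in> V.span X" "\<And>y. y \<in> X \<Longrightarrow> c * y \<in> V.span Y" for c x X Y
    using that(1)
  proof (induction rule: V.span_induct_alt)
    case base
    then show ?case by (simp add: V.span_zero)
  next
    case (step q x y)
    have "c * (of_rat q * x + y) = of_rat q * (c * x) + c * y" by (simp add: algebra_simps)
    then show ?case using step that(2) by (simp add: V.span_add V.span_scale)
  qed
  \<comment> \<open>Positivity of \<open>n\<close> admits the exponent 0, hence the old span lies in
    the new one.\<close>
  have npos: "n > 0"
  proof (rule ccontr)
    assume "\<not> n > 0"
    then obtain a where "min_poly t = [:a:]" unfolding n_def by (metis degree_eq_zeroE neq0_conv)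
    then show False using min_poly(1,2)[OF alg[of t]] by simp
  qed
  have tn: "t ^ n = - (\<Sum>i<n. of_rat (coeff (min_poly t) i) * t ^ i)"
  proof -
    have d: "degree (map_poly of_rat (min_poly t) :: 'k poly) = n"
      unfolding n_def by (rule map_poly_degree_eq) (use min_poly(1)[OF alg[of t]] in auto)
    have "(\<Sum>i\<le>n. of_rat (coeff (min_poly t) i) * t ^ i) = 0"
      using min_poly(2)[OF alg[of t]] d by (simp add: rat_eval_def poly_altdef coeff_map_poly)
    then show ?thesis
      using min_poly(1)[OF alg[of t]]
      by (simp add: n_def lessThan_Suc_atMost[symmetric] eq_neg_iff_add_eq_0 add.commute)
  qed
  have bt: "b * t ^ i \<in> V.span B'" if "b \<in> V.span B" "i < n" for b i
  proof -
    have "t ^ i * b \<in> V.span B'" using that(1)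
    proof (rule stable)
      fix y assume "y \<in> B"
      then have "y * t ^ i \<in> B'" using that(2) unfolding B'_def by force
      then show "t ^ i * y \<in> V.span B'" by (simp add: V.span_base mult.commute[of "t ^ i"])
    qed
    then show ?thesis by (simp add: mult.commute[of "t ^ i"])
  qed
  have mult_t: "t * x \<in> V.span B'" if "x \<in> V.span B'" for x
    using that
  proof (rule stable)
    fix y assume "y \<in> B'"
    then obtain b i where bi: "b \<in> B" "i < n" "y = b * t ^ i" by (auto simp: B'_def)
    show "t * y \<in> V.span B'"
    proof (cases "Suc i < n")
      case True
      then show ?thesis using bt[OF V.span_base[OF bi(1)] True] bi(3) by (simp add: algebra_simps)
    next
      case False
      \<comment> \<open>Here \<open>i = n - 1\<close>, the only exponent that overflows;
        \<open>tn\<close> brings it back below \<open>n\<close>.\<close>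
      then have "t * y = b * t ^ n"
        using bi by (metis Suc_lessI mult.left_commute power_Suc)
      also have "\<dots> = - (\<Sum>i<n. of_rat (coeff (min_poly t) i) * (b * t ^ i))"
        by (simp add: tn sum_distrib_left algebra_simps)
      finally show ?thesis
        using bt[OF V.span_base[OF bi(1)]] by (auto intro!: V.span_neg V.span_sum V.span_scale)
    qed
  qed
  have mult_b: "b * x \<in> V.span B'" if "b \<in> V.span B" "x \<in> V.span B'" for b x
    using that(2)
  proof (rule stable)
    fix y assume "y \<in> B'"
    then obtain c i where ci: "c \<in> B" "i < n" "y = c * t ^ i" by (auto simp: B'_def)
    then show "b * y \<in> V.span B'"
      using bt[OF B(4)[OF that(1) V.span_base[OF ci(1)]] ci(2)] by (simp add: mult.assoc)
  qed
  have mult_pow: "t ^ i * x \<in> V.span B'" if "x \<in> V.span B'" for x i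
    by (induction i) (simp_all add: that mult.assoc mult_t)
  have mult: "x * y \<in> V.span B'" if "x \<in> V.span B'" "y \<in> V.span B'" for x y
    using that(2)
  proof (rule stable)
    fix y assume "y \<in> B'"
    then obtain c i where ci: "c \<in> B" "i < n" "y = c * t ^ i" by (auto simp: B'_def)
    then have "x * y = c * (t ^ i * x)" by simp
    also have "\<dots> \<in> V.span B'" by (rule mult_b[OF V.span_base[OF ci(1)] mult_pow[OF that(1)]])
    finally show "x * y \<in> V.span B'" .
  qed
  have sub: "V.span B \<subseteq> V.span B'" using bt[OF _ npos] by auto
  have "t * 1 \<in> V.span B'" using sub B(3) by (intro mult_t) blast
  moreover have "finite B'" using B(1) by (simp add: B'_def)
  ultimately show ?case
    unfolding rat_span_def using sub B(2,3) mult by (intro exI[of _ B']) auto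
qed

text \<open>The subalgebra containing \<open>T\<close> has finite dimension over \<rat>, so it
  cannot be all of \<open>K\<close>.\<close>

lemma proper_subring_of_infinite_degree:
  fixes T :: "'k::field_char_0 set"
  assumes alg: "\<And>x::'k. algebraic x" and inf: "infinite_degree_over_rat TYPE('k)" and "finite T"
  shows "\<exists>F. is_subring F \<and> range of_rat \<subseteq> F \<and> T \<subseteq> F \<and> F \<noteq> UNIV"
proof -
  interpret V: vector_space "\<lambda>(q::rat) (x::'k). of_rat q * x" by (rule vector_space_rat)
  obtain B where B: "finite B" "T \<subseteq> V.span B" "1 \<in> V.span B"
    "\<And>x y. x \<in> V.span B \<Longrightarrow> y \<in> V.span B \<Longrightarrow> x * y \<in> V.span B"
    using finite_dimensional_subalgebra[OF alg assms(3)] by blast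
  have "is_subring (V.span B)" using B(3,4) by (simp add: is_subring_def V.span_diff)
  moreover have "range of_rat \<subseteq> V.span B" using V.span_scale[OF B(3)] by auto
  moreover have "V.span B \<noteq> UNIV"
  proof
    assume U: "V.span B = UNIV"
    \<comment> \<open>Finite dimension is expressed through a basis, so the spanning set is thinned
      to an independent one.\<close>
    obtain C where C: "C \<subseteq> B" "V.independent C" "B \<subseteq> V.span C"
      using V.maximal_independent_subset[of B] by blast
    have "V.span C = UNIV" using U V.span_minimal[OF C(3) V.subspace_span] by blast
    then have "finite_dimensional_vector_space (\<lambda>(q::rat) (x::'k). of_rat q * x) C"
      using C(2) finite_subset[OF C(1) B(1)] by unfold_locales auto
    then show False using inf unfolding infinite_degree_over_rat_def by blast
  qed
  ultimately show ?thesis using B(2) by blast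
qed

section \<open>Orthogonal bases\<close>

locale quadratic_space = vector_space scale
  for scale :: "'k::field_char_0 \<Rightarrow> 'v::ab_group_add \<Rightarrow> 'v" +
  fixes Q :: "'v \<Rightarrow> 'k"
  assumes quadratic_map: "quadratic_map scale Q"
begin

lemma Q_scale: "Q (scale a v) = a\<^sup>2 * Q v"
  using quadratic_map by (simp add: quadratic_map_def)

lemma polar_left:
  "polar Q (v + w) u = polar Q v u + polar Q w u" "polar Q (scale a v) u = a * polar Q v u"
  "polar Q 0 u = 0" "polar Q (v - w) u = polar Q v u - polar Q w u"
  "polar Q (\<Sum>i\<in>I. f i) u = (\<Sum>i\<in>I. polar Q (f i) u)"
proof -
  have "Vector_Spaces.linear scale (*) (\<lambda>v. polar Q v u)"
    using quadratic_map by (simp add: quadratic_map_def)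
  then interpret l: Vector_Spaces.linear scale "(*)" "\<lambda>v. polar Q v u" .
  show "polar Q (v + w) u = polar Q v u + polar Q w u" "polar Q (scale a v) u = a * polar Q v u"
    "polar Q 0 u = 0" "polar Q (v - w) u = polar Q v u - polar Q w u"
    "polar Q (\<Sum>i\<in>I. f i) u = (\<Sum>i\<in>I. polar Q (f i) u)"
    by (rule l.add l.scale l.zero l.diff l.sum)+
qed

lemma polar_commute: "polar Q v w = polar Q w v"
  by (simp add: polar_def add.commute)

lemma polar_self: "polar Q v v = Q v"
proof -
  have "v + v = scale 2 v" using scale_left_distrib[of 1 1 v] by simp
  then show ?thesis by (simp add: polar_def Q_scale)
qed

text \<open>The coefficient of the orthogonal projection of \<open>v\<close> onto the line of
  \<open>u\<close>, meaningful when \<open>Q u \<noteq> 0\<close>.\<close>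

definition coord :: "'v \<Rightarrow> 'v \<Rightarrow> 'k" where
  "coord u v = polar Q v u / Q u"

definition orthogonal_set :: "'v set \<Rightarrow> bool" where
  "orthogonal_set U \<longleftrightarrow> finite U \<and> (\<forall>u\<in>U. Q u \<noteq> 0) \<and>
     (\<forall>u\<in>U. \<forall>u'\<in>U. u \<noteq> u' \<longrightarrow> polar Q u u' = 0)"

lemma polar_orthogonal_sum:
  assumes "orthogonal_set U" "u \<in> U"
  shows "polar Q (\<Sum>u'\<in>U. scale (a u') u') u = a u * Q u"
proof -
  have "polar Q (\<Sum>u'\<in>U. scale (a u') u') u = (\<Sum>u'\<in>U. if u' = u then a u * Q u else 0)"
    unfolding polar_left
    using assms by (intro sum.cong) (auto simp: orthogonal_set_def polar_left polar_self)
  then show ?thesis using assms by (simp add: orthogonal_set_def)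
qed

lemma orthogonal_expansion:
  assumes U: "orthogonal_set U" and v: "v \<in> span U"
  shows "v = (\<Sum>u\<in>U. scale (coord u v) u)"
proof -
  obtain a where a: "v = (\<Sum>u\<in>U. scale (a u) u)"
    using v U span_finite[of U] by (auto simp: orthogonal_set_def)
  have "coord u v = a u" if "u \<in> U" for u
    using polar_orthogonal_sum[OF U that, of a] a U that by (simp add: coord_def orthogonal_set_def)
  then show ?thesis using a by simp
qed

lemma orthogonal_value:
  assumes U: "orthogonal_set U" and v: "v \<in> span U"
  shows "Q v = (\<Sum>u\<in>U. (coord u v)\<^sup>2 * Q u)"
proof -
  \<comment> \<open>Keeping \<open>w\<close> general expands only the first argument;
    \<open>w = v\<close> is substituted afterwards.\<close>
  have "polar Q v w = (\<Sum>u\<in>U. coord u v * polar Q w u)" for w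
    by (subst orthogonal_expansion[OF U v]) (simp add: polar_left polar_commute[of w])
  then have "Q v = (\<Sum>u\<in>U. coord u v * polar Q v u)" using polar_self by metis
  also have "\<dots> = (\<Sum>u\<in>U. (coord u v)\<^sup>2 * Q u)"
    using U by (intro sum.cong) (auto simp: coord_def orthogonal_set_def power2_eq_square)
  finally show ?thesis .
qed

text \<open>Gram-Schmidt: anisotropy on the span ensures that each nonzero remainder can join the
  orthogonal set.\<close>

lemma exists_orthogonal_set:
  assumes "finite G" "\<And>w. w \<in> span G \<Longrightarrow> w \<noteq> 0 \<Longrightarrow> Q w \<noteq> 0"
  shows "\<exists>U. orthogonal_set U \<and> U \<subseteq> span G \<and> G \<subseteq> span U"
  using assms
proof (induction)
  case empty
  then show ?case by (intro exI[of _ "{}"]) (simp add: orthogonal_set_def)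
next
  case (insert g G)
  have mono: "span G \<subseteq> span (insert g G)" by (intro span_mono) auto
  then obtain U where U: "orthogonal_set U" "U \<subseteq> span G" "G \<subseteq> span U"
    using insert.IH insert.prems by blast
  define p where "p = (\<Sum>u\<in>U. scale (coord u g) u)"
  have p: "p \<in> span U" unfolding p_def by (intro span_sum span_scale span_base)
  have orth: "polar Q (g - p) u = 0" if "u \<in> U" for u
    using polar_orthogonal_sum[OF U(1) that, of "\<lambda>u. coord u g"] U(1) that
    by (simp add: polar_left(4) p_def) (simp add: coord_def orthogonal_set_def)
  have w: "g - p \<in> span (insert g G)"
  proof (rule span_diff)
    show "p \<in> span (insert g G)" using p span_minimal[OF U(2) subspace_span] mono by blast
  qed (simp add: span_base)
  show ?case
  proof (cases "g - p = 0")
    case True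
    then show ?thesis using U mono p by (intro exI[of _ U]) auto
  next
    case False
    then have Q: "Q (g - p) \<noteq> 0" using insert.prems w by blast
    have "orthogonal_set (insert (g - p) U)"
      using U(1) Q orth polar_commute unfolding orthogonal_set_def by (metis finite_insert insert_iff)
    moreover have sub: "span U \<subseteq> span (insert (g - p) U)" by (intro span_mono) auto
    have "(g - p) + p \<in> span (insert (g - p) U)"
      using p sub by (intro span_add) (auto intro: span_base)
    ultimately show ?thesis
      using U w mono sub by (intro exI[of _ "insert (g - p) U"]) auto
  qed
qed

end

section \<open>Totally positive elements and the Northcott property\<close>

text \<open>An integer slightly above \<open>s\<close> makes all real images positive and only about
  doubles the bound on them.\<close>

lemma shift_totally_positive:
  fixes z :: "'k::field_char_0"
  assumes tr: "\<And>x::'k. totally_real x"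
    and bound: "\<And>r. embedding r \<Longrightarrow> \<bar>r z\<bar> \<le> s"
  obtains n :: nat where "totally_positive (z + of_nat n)" "house (z + of_nat n) < 2 * s + 4"
proof -
  define n where "n = nat \<lceil>s\<rceil> + 1"
  \<comment> \<open>The existence of some embedding gives \<open>s \<ge> 0\<close>, so
    \<open>nat\<close> does not truncate.\<close>
  obtain r0 :: "'k \<Rightarrow> real" where "embedding r0" using house_attained[OF tr] by blast
  then have "s \<ge> 0" using bound[of r0] by linarith
  then have n: "s < real n" "real n < s + 2" unfolding n_def by linarith+
  have r: "r (z + of_nat n) = r z + real n" if "embedding r" for r :: "'k \<Rightarrow> real"
    by (simp add: embedding_simps[OF that])
  have "totally_positive (z + of_nat n)"
    unfolding totally_positive_iff_embeddings[OF tr]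
  proof (intro allI impI)
    fix r :: "'k \<Rightarrow> real" assume e: "embedding r"
    show "r (z + of_nat n) > 0" using bound[OF e] n(1) r[OF e] by linarith
  qed
  moreover obtain r1 :: "'k \<Rightarrow> real" where r1: "embedding r1" "house (z + of_nat n) = \<bar>r1 (z + of_nat n)\<bar>"
    using house_attained[OF tr] by blast
  then have "house (z + of_nat n) < 2 * s + 4"
    using bound[OF r1(1)] n r[OF r1(1)] by linarith
  ultimately show thesis by (rule that)
qed

lemma subalgebra_cancel_of_nat:
  fixes x :: "'k::field_char_0"
  assumes F: "is_subring F" "range of_rat \<subseteq> F" and x: "of_nat m * x \<in> F" "m > 0"
  shows "x \<in> F"
proof -
  have "of_rat (inverse (of_nat m)) * (of_nat m * x) \<in> F"
    by (intro is_subring_closed(5)[OF F(1) _ x(1)] subsetD[OF F(2)] rangeI)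
  then show ?thesis using x(2) by (simp add: of_rat_inverse mult.assoc[symmetric])
qed

text \<open>Start from any element outside \<open>F\<close>, clear its denominator to reach
  \<open>\<O>\<close>, and add an integer to gain positivity. Neither operation can lead into
  \<open>F\<close>, which contains \<rat>.\<close>

lemma exists_totally_positive_notin:
  fixes \<O> F :: "'k::field_char_0 set"
  assumes tr: "\<And>x::'k. totally_real x" and \<O>: "is_subring \<O>" "Frac \<O> = UNIV"
    and F: "is_subring F" "range of_rat \<subseteq> F" "F \<noteq> UNIV"
  shows "\<exists>a\<in>\<O>. totally_positive a \<and> a \<notin> F"
proof -
  have alg: "algebraic x" for x :: 'k using tr by (simp add: totally_real_def)
  obtain x where x: "x \<notin> F" using F(3) by blast
  obtain m :: nat where m: "m > 0" "of_nat m * x \<in> \<O>" using is_subring_denominator[OF \<O> alg] by blast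
  have mx: "of_nat m * x \<notin> F" using subalgebra_cancel_of_nat[OF F(1,2)] m(1) x by blast
  obtain n :: nat where n: "totally_positive (of_nat m * x + of_nat n)"
    by (rule shift_totally_positive[OF tr abs_embedding_le_house[OF tr]])
  have "of_nat m * x + of_nat n \<notin> F"
    using is_subring_closed(4)[OF F(1) _ is_subring_of_nat[OF F(1), of n], of "of_nat m * x + of_nat n"] mx
    by auto
  then show ?thesis
    using n is_subring_closed(3)[OF \<O>(1) m(2) is_subring_of_nat[OF \<O>(1)]] by blast
qed

text \<open>Only finitely many candidates have house below \<open>house a + 1\<close>; the summand 1
  keeps \<open>a\<close> among them despite the strict inequality.\<close>

lemma northcott_minimal:
  assumes "northcott_house S" "a \<in> S" "a \<notin> F"
  shows "\<exists>b\<in>S - F. \<forall>c\<in>S - F. house b \<le> house c"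
proof -
  define X where "X = {x \<in> S - F. house x < house a + 1}"
  have "finite X"
    using assms(1)[unfolded northcott_house_def, rule_format, of "house a + 1"]
    by (rule finite_subset[rotated]) (auto simp: X_def)
  moreover have aX: "a \<in> X" using assms by (simp add: X_def)
  ultimately obtain b where b: "b \<in> X" "\<And>c. c \<in> X \<Longrightarrow> house b \<le> house c"
    using ex_min_if_finite[of "house ` X"] by (metis empty_iff arg_min_if_finite(1,2) leI)
  have "house b \<le> house c" if "c \<in> S - F" for c
    using b(2)[of c] b(2)[OF aX] that by (cases "house c < house a + 1") (auto simp: X_def)
  then show ?thesis using b(1) by (auto simp: X_def)
qed

theorem theorem3p1:
  fixes \<O> :: "'k::field_char_0 set"
  assumes "\<forall>x::'k. totally_real x"
    and "infinite_degree_over_rat TYPE('k)"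
    and "is_subring \<O>"
    and "\<O> \<subseteq> {x. algebraic_int x}"
    and "Frac \<O> = UNIV"
    and "northcott_house {x\<in>\<O>. totally_positive x}"
  shows "\<not> (\<exists>(scale :: 'k \<Rightarrow> 'v::ab_group_add \<Rightarrow> 'v) L q. universal_lattice scale \<O> L q)"
proof
  assume "\<exists>(scale :: 'k \<Rightarrow> 'v \<Rightarrow> 'v) L q. universal_lattice scale \<O> L q"
  then obtain scale :: "'k \<Rightarrow> 'v \<Rightarrow> 'v" and L q where univ: "universal_lattice scale \<O> L q" by blast
  note tr = assms(1)[rule_format]
  have alg: "algebraic x" for x :: 'k using tr by (simp add: totally_real_def)
  note \<O> = assms(3)
  note tp_iff = totally_positive_iff_embeddings[OF tr]
  from univ have pos: "\<And>v. v \<in> L \<Longrightarrow> v \<noteq> 0 \<Longrightarrow> totally_positive (q v)"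
    and rep: "\<And>a. a \<in> \<O> \<Longrightarrow> totally_positive a \<Longrightarrow> \<exists>v\<in>L. q v = a"
    and lat: "quadratic_lattice scale \<O> L q"
    by (auto simp: universal_lattice_def positive_definite_lattice_def integral_lattice_def)
  obtain Bs where fd: "finite_dimensional_vector_space scale Bs"
    using lat by (auto simp: quadratic_lattice_def is_lattice_def)
  obtain G where G: "finite G" "L = {\<Sum>g\<in>G. scale (a g) g | a. \<forall>g\<in>G. a g \<in> \<O>}"
    using lat by (auto simp: quadratic_lattice_def is_lattice_def)
  obtain Q where Q: "quadratic_map scale Q" "\<And>v. v \<in> L \<Longrightarrow> q v = Q v"
    using lat by (auto simp: quadratic_lattice_def)
  interpret V: finite_dimensional_vector_space scale Bs by (rule fd)
  interpret V: quadratic_space scale Q by unfold_locales (rule Q(1))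
  have L_span: "v \<in> V.span G" if v: "v \<in> L" for v
  proof -
    obtain a where "v = (\<Sum>g\<in>G. scale (a g) g)" using v G(2) by blast
    then show ?thesis by (simp add: V.span_sum V.span_scale V.span_base)
  qed
  \<comment> \<open>Positivity passes from the lattice to its \<open>K\<close>-span: a positive
    integer multiple of \<open>w\<close> lies in \<open>L\<close>, which changes \<open>Q w\<close>
    only by the square of that integer.\<close>
  have Q_pos: "totally_positive (Q w)" if w: "w \<in> V.span G" "w \<noteq> 0" for w
  proof -
    obtain a where a: "w = (\<Sum>g\<in>G. scale (a g) g)" using w(1) V.span_finite[OF G(1)] by auto
    obtain n :: nat where n: "n > 0" "\<And>g. g \<in> G \<Longrightarrow> of_nat n * a g \<in> \<O>"
      using is_subring_common_denominator[OF \<O> assms(5) alg, of "a ` G"] G(1) by auto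
    have "scale (of_nat n) w = (\<Sum>g\<in>G. scale (of_nat n * a g) g)"
      by (simp add: a V.scale_sum_right)
    then have L: "scale (of_nat n) w \<in> L"
      unfolding G(2) using n(2) by (intro CollectI exI[of _ "\<lambda>g. of_nat n * a g"]) simp
    then have "totally_positive (Q (scale (of_nat n) w))"
      using pos[OF L] Q(2)[OF L] w(2) n(1) by simp
    then have "\<forall>r::'k \<Rightarrow> real. embedding r \<longrightarrow> 0 < (real n)\<^sup>2 * r (Q w)"
      by (simp add: tp_iff V.Q_scale embedding_simps)
    then show ?thesis by (simp add: tp_iff zero_less_mult_iff)
  qed
  have "Q w \<noteq> 0" if "w \<in> V.span G" "w \<noteq> 0" for w
  proof
    assume "Q w = 0"
    obtain r :: "'k \<Rightarrow> real" where r: "embedding r" using house_attained[OF tr] by blast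
    then have "r (Q w) > 0" using Q_pos[OF that] by (simp add: tp_iff)
    then show False using \<open>Q w = 0\<close> by (simp add: embedding_simps[OF r])
  qed
  then obtain U where U: "V.orthogonal_set U" "U \<subseteq> V.span G" "G \<subseteq> V.span U"
    using V.exists_orthogonal_set[OF G(1)] by blast
  have finU: "finite U" using U(1) by (simp add: V.orthogonal_set_def)
  have Qu: "r (Q u) > 0" if "u \<in> U" "embedding r" for u and r :: "'k \<Rightarrow> real"
  proof -
    have "Q u \<noteq> 0" using U(1) that(1) by (simp add: V.orthogonal_set_def)
    then have "u \<noteq> 0" using V.polar_left(3) V.polar_self by metis
    then show ?thesis using Q_pos[of u] U(2) that by (auto simp: tp_iff)
  qed
  \<comment> \<open>The denominator depends only on the generators \<open>G\<close> and on
    \<open>U\<close>; by linearity it serves all vectors of \<open>L\<close>.\<close>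
  obtain d :: nat where d: "d > 0" "\<And>g u. g \<in> G \<Longrightarrow> u \<in> U \<Longrightarrow> of_nat d * V.coord u g \<in> \<O>"
    using is_subring_common_denominator[OF \<O> assms(5) alg, of "(\<lambda>(g, u). V.coord u g) ` (G \<times> U)"] G(1) finU
    by auto
  have coord_\<O>: "of_nat d * V.coord u v \<in> \<O>" if v: "v \<in> L" and u: "u \<in> U" for u v
  proof -
    obtain a where a: "v = (\<Sum>g\<in>G. scale (a g) g)" "\<And>g. g \<in> G \<Longrightarrow> a g \<in> \<O>" using v G(2) by blast
    have "of_nat d * V.coord u v = (\<Sum>g\<in>G. a g * (of_nat d * V.coord u g))"
      by (simp add: V.coord_def a(1) V.polar_left sum_distrib_left sum_divide_distrib algebra_simps)
    then show ?thesis
      using a(2) d(2)[OF _ u] by (simp add: is_subring_sum[OF \<O>] is_subring_closed(5)[OF \<O>])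
  qed
  \<comment> \<open>A bound for all \<open>1 / r (Q u)\<close>, uniform in \<open>u\<close> and
    \<open>r\<close>; a sum also makes sense for empty \<open>U\<close>.\<close>
  define M where "M = (\<Sum>u\<in>U. house (inverse (Q u)))"
  have house_nonneg: "house x \<ge> 0" for x :: 'k using house_attained[OF tr, of x] by auto
  have M: "r (inverse (Q u)) \<le> M" if "u \<in> U" "embedding r" for u and r :: "'k \<Rightarrow> real"
  proof -
    have "r (inverse (Q u)) \<le> house (inverse (Q u))"
      using abs_embedding_le_house[OF tr that(2), of "inverse (Q u)"] by linarith
    also have "\<dots> \<le> M" unfolding M_def using finU that(1) house_nonneg by (intro member_le_sum) auto
    finally show ?thesis .
  qed
  have M0: "M \<ge> 0" unfolding M_def by (intro sum_nonneg house_nonneg)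
  define C where "C = (real d)\<^sup>2 * M"
  have C0: "C \<ge> 0" using M0 by (simp add: C_def)
  \<comment> \<open>The values \<open>Q u\<close> are included so that coordinates in
    \<open>F\<close> would force \<open>Q v\<close> into \<open>F\<close>. In the threshold,
    \<open>16 * C\<close> yields \<open>sqrt (C * h) \<le> h / 4\<close> for
    \<open>h = house a\<close>, and 8 contradicts the resulting
    \<open>h < h / 2 + 4\<close>.\<close>
  define T where "T = Q ` U \<union> {x \<in> {x\<in>\<O>. totally_positive x}. house x < 16 * C + 8}"
  have T: "finite T" using finU assms(6) unfolding T_def northcott_house_def by blast
  obtain F where F: "is_subring F" "range of_rat \<subseteq> F" "T \<subseteq> F" "F \<noteq> UNIV"
    using proper_subring_of_infinite_degree[OF alg assms(2) T] by blast
  obtain a where a: "a \<in> \<O>" "totally_positive a" "a \<notin> F"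
    and amin: "\<And>c. c \<in> \<O> \<Longrightarrow> totally_positive c \<Longrightarrow> c \<notin> F \<Longrightarrow> house a \<le> house c"
  proof -
    obtain a0 where "a0 \<in> {x\<in>\<O>. totally_positive x}" "a0 \<notin> F"
      using exists_totally_positive_notin[OF tr \<O> assms(5) F(1,2,4)] by blast
    from northcott_minimal[OF assms(6) this] show thesis using that by auto
  qed
  have big: "house a \<ge> 16 * C + 8" 
  proof (rule ccontr)
    assume "\<not> house a \<ge> 16 * C + 8"
    then have "a \<in> T" using a(1,2) by (simp add: T_def)
    then show False using a(3) F(3) by blast
  qed
  obtain v where v: "v \<in> L" "Q v = a" using rep[OF a(1,2)] Q(2) by metis
  have vU: "v \<in> V.span U" using L_span[OF v(1)] V.span_minimal[OF U(3) V.subspace_span] by blast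
  have exp: "a = (\<Sum>u\<in>U. (V.coord u v)\<^sup>2 * Q u)" using V.orthogonal_value[OF U(1) vU] v(2) by simp
  have "\<exists>u\<in>U. V.coord u v \<notin> F"
  proof (rule ccontr)
    assume "\<not> (\<exists>u\<in>U. V.coord u v \<notin> F)"
    then have "a \<in> F"
      unfolding exp power2_eq_square using F(3)
      by (intro is_subring_sum[OF F(1)] is_subring_closed(5)[OF F(1)]) (auto simp: T_def)
    then show False using a(3) by simp
  qed
  then obtain u where u: "u \<in> U" "V.coord u v \<notin> F" by blast
  define z where "z = of_nat d * V.coord u v"
  have "z \<notin> F" using subalgebra_cancel_of_nat[OF F(1,2)] d(1) u(2) unfolding z_def by blast
  have bound: "\<bar>r z\<bar> \<le> sqrt (C * house a)" if r: "embedding r" for r :: "'k \<Rightarrow> real"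
  proof -
    \<comment> \<open>Every summand is nonnegative under \<open>r\<close>, so a single one is at
      most \<open>r a\<close>.\<close>
    have "r ((V.coord u v)\<^sup>2 * Q u) \<le> (\<Sum>u\<in>U. r ((V.coord u v)\<^sup>2 * Q u))"
      using finU u(1) Qu[OF _ r] by (intro member_le_sum) (auto simp: embedding_simps[OF r] less_imp_le)
    also have "\<dots> = r a" by (subst exp) (simp add: embedding_sum[OF r])
    also have "\<dots> \<le> house a" using abs_embedding_le_house[OF tr r, of a] by linarith
    finally have "(r (V.coord u v))\<^sup>2 * r (Q u) \<le> house a" by (simp add: embedding_simps[OF r])
    then have "(r (V.coord u v))\<^sup>2 \<le> house a * r (inverse (Q u))"
      using Qu[OF u(1) r] by (simp add: embedding_inverse[OF r]) (simp add: field_simps)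
    also have "\<dots> \<le> house a * M" using M[OF u(1) r] house_nonneg by (intro mult_left_mono)
    finally have "(real d)\<^sup>2 * (r (V.coord u v))\<^sup>2 \<le> (real d)\<^sup>2 * (house a * M)" by (intro mult_left_mono) auto
    then have "(r z)\<^sup>2 \<le> C * house a"
      by (simp add: z_def C_def embedding_simps[OF r] power_mult_distrib algebra_simps)
    then show ?thesis using real_sqrt_le_mono[of "(r z)\<^sup>2"] by simp
  qed
  obtain n :: nat where n: "totally_positive (z + of_nat n)"
    "house (z + of_nat n) < 2 * sqrt (C * house a) + 4"
    by (rule shift_totally_positive[OF tr bound])
  have "z + of_nat n \<notin> F"
    using is_subring_closed(4)[OF F(1) _ is_subring_of_nat[OF F(1), of n], of "z + of_nat n"] \<open>z \<notin> F\<close>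
    by auto
  moreover have "z + of_nat n \<in> \<O>"
    using coord_\<O>[OF v(1) u(1)] is_subring_of_nat[OF \<O>] is_subring_closed(3)[OF \<O>] by (simp add: z_def)
  \<comment> \<open>The shifted \<open>z\<close> is a totally positive element of
    \<open>\<O>\<close> outside \<open>F\<close>, so the minimality of \<open>house a\<close>
    applies to it.\<close>
  ultimately have "house a < 2 * sqrt (C * house a) + 4" using amin[OF _ n(1)] n(2) by linarith
  moreover have "sqrt (C * house a) \<le> house a / 4"
  proof (rule real_le_lsqrt)
    have "16 * C * house a \<le> house a * house a" using big house_nonneg by (intro mult_right_mono) auto
    then show "C * house a \<le> (house a / 4)\<^sup>2" by (simp add: power2_eq_square)
  qed (use house_nonneg in auto)
  ultimately show False using big C0 by linarith
qed

end
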